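(* For a Banach lattice $E$ the following assertions are equivalent: (1) The norm of $E'$ is order continuous. (2) For each Banach space $Y$ and every operator $T : E \to Y$ such that $T' : Y' \to E'$ is strong order bounded, $T$ is M-weakly compact. (3) For every operator $T : E \to \ell_\infty$, if $T' : \ell_\infty' \to E'$ is strong order bounded, then $T$ is M-weakly compact.
   Context: All Banach spaces and Banach lattices are real; "operator" means bounded linear map; $G'$ denotes the topological dual (a Banach lattice when $G$ is one), and $T'$ the adjoint of $T$. An operator from a Banach space $X$ into a Banach lattice $F$ is strong order bounded if it maps the unit ball of $X$ into an order bounded subset of $F$. An operator $T$ from a Banach lattice $E$ into a Banach space $Y$ is M-weakly compact if $\lim \|T(x_n)\| = 0$ for every norm bounded disjoint sequence $(x_n)$ in $E$. *)

theory Defs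
  imports "HOL-Analysis.Analysis" "HOL-Library.Lattice_Algebras"
begin

class banach_lattice = banach + ordered_real_vector + lattice_ab_group_add_abs +
  assumes norm_mono_abs: "\<bar>x\<bar> \<le> \<bar>y\<bar> \<Longrightarrow> norm x \<le> norm y"

instance real :: banach_lattice
  by standard (auto simp: sup_real_def)

text \<open>The dual \<open>E'\<close> of a Banach lattice \<open>E\<close> is the type \<open>'a \<Rightarrow>\<^sub>L real\<close> with the operator norm and the
  usual order, \<open>f \<le> g\<close> iff \<open>g - f\<close> is positive. The notions below that are applied to \<open>E'\<close> depend
  only on its order and its norm.\<close>

instantiation blinfun :: (banach_lattice, "{real_normed_vector, ordered_real_vector}") order
begin

definition less_eq_blinfun :: "'a \<Rightarrow>\<^sub>L 'b \<Rightarrow> 'a \<Rightarrow>\<^sub>L 'b \<Rightarrow> bool" where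
  "less_eq_blinfun f g \<longleftrightarrow> (\<forall>x\<ge>0. blinfun_apply f x \<le> blinfun_apply g x)"

definition less_blinfun :: "'a \<Rightarrow>\<^sub>L 'b \<Rightarrow> 'a \<Rightarrow>\<^sub>L 'b \<Rightarrow> bool" where
  "less_blinfun f g \<longleftrightarrow> f \<le> g \<and> \<not> g \<le> f"

instance
proof
  fix f g h :: "'a \<Rightarrow>\<^sub>L 'b"
  show "f < g \<longleftrightarrow> f \<le> g \<and> \<not> g \<le> f" by (rule less_blinfun_def)
  show "f \<le> f" by (simp add: less_eq_blinfun_def)
  show "f \<le> g \<Longrightarrow> g \<le> h \<Longrightarrow> f \<le> h"
    unfolding less_eq_blinfun_def by (meson order_trans)
  assume "f \<le> g" "g \<le> f"
  then have eq: "blinfun_apply f x = blinfun_apply g x" if "x \<ge> 0" for x :: 'a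
    using that unfolding less_eq_blinfun_def by (meson order_antisym)
  show "f = g"
  proof (rule blinfun_eqI)
    fix x :: 'a
    have "x = pprt x - pprt (- x)"
      using prts[of x] by (simp add: pprt_neg)
    then show "blinfun_apply f x = blinfun_apply g x"
      using eq[of "pprt x"] eq[of "pprt (- x)"] by (metis blinfun.diff_right zero_le_pprt)
  qed
qed

end

text \<open>A net \<open>x\<^sub>\<alpha> \<down> 0\<close> is represented by its range: a downward directed set with infimum \<open>0\<close>, indexed
  by itself.\<close>

definition order_continuous_norm :: "'f::{real_normed_vector, order} itself \<Rightarrow> bool" where
  "order_continuous_norm _ \<longleftrightarrow>
    (\<forall>D :: 'f set.
       D \<noteq> {} \<and> (\<forall>x\<in>D. \<forall>y\<in>D. \<exists>z\<in>D. z \<le> x \<and> z \<le> y) \<and>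
       (\<forall>x\<in>D. 0 \<le> x) \<and> (\<forall>b. (\<forall>x\<in>D. b \<le> x) \<longrightarrow> b \<le> 0) \<longrightarrow>
       (\<forall>e>0. \<exists>x0\<in>D. \<forall>x\<in>D. x \<le> x0 \<longrightarrow> norm x < e))"

text \<open>HOL cannot quantify over types inside a formula. A Banach space is therefore also represented by
  a linear subspace \<open>V\<close> of a real vector space type together with a complete norm \<open>N\<close> on \<open>V\<close>
  (the values of \<open>N\<close> outside \<open>V\<close> are irrelevant). Every \<open>'y::banach\<close> is the case
  \<open>V = UNIV\<close>, \<open>N = norm\<close>.\<close>

definition banach_space_on :: "'v::real_vector set \<Rightarrow> ('v \<Rightarrow> real) \<Rightarrow> bool" where
  "banach_space_on V N \<longleftrightarrow>
     subspace V \<and>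
     (\<forall>x\<in>V. 0 \<le> N x) \<and> (\<forall>x\<in>V. N x = 0 \<longleftrightarrow> x = 0) \<and>
     (\<forall>x\<in>V. \<forall>c. N (c *\<^sub>R x) = \<bar>c\<bar> * N x) \<and>
     (\<forall>x\<in>V. \<forall>y\<in>V. N (x + y) \<le> N x + N y) \<and>
     (\<forall>X :: nat \<Rightarrow> 'v. (\<forall>n. X n \<in> V) \<and>
        (\<forall>e>0. \<exists>M. \<forall>m\<ge>M. \<forall>n\<ge>M. N (X m - X n) < e) \<longrightarrow>
        (\<exists>l\<in>V. (\<lambda>n. N (X n - l)) \<longlonglongrightarrow> 0))"

definition operator_into ::
  "'v::real_vector set \<Rightarrow> ('v \<Rightarrow> real) \<Rightarrow> ('a::real_normed_vector \<Rightarrow> 'v) \<Rightarrow> bool" where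
  "operator_into V N T \<longleftrightarrow> linear T \<and> range T \<subseteq> V \<and> (\<exists>K. \<forall>x. N (T x) \<le> K * norm x)"

text \<open>Functionals on \<open>V\<close> are extended by \<open>0\<close>, so that each element of the dual of \<open>(V, N)\<close> is
  represented by exactly one function.\<close>

definition dual_on :: "'v::real_vector set \<Rightarrow> ('v \<Rightarrow> real) \<Rightarrow> ('v \<Rightarrow> real) set" where
  "dual_on V N = {f. (\<forall>x\<in>V. \<forall>y\<in>V. f (x + y) = f x + f y) \<and>
                     (\<forall>x\<in>V. \<forall>c. f (c *\<^sub>R x) = c * f x) \<and>
                     (\<exists>K. \<forall>x\<in>V. \<bar>f x\<bar> \<le> K * N x) \<and>
                     (\<forall>x. x \<notin> V \<longrightarrow> f x = 0)}"

definition dual_norm_on :: "'v::real_vector set \<Rightarrow> ('v \<Rightarrow> real) \<Rightarrow> ('v \<Rightarrow> real) \<Rightarrow> real" where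
  "dual_norm_on V N f = (SUP x\<in>{x \<in> V. N x \<le> 1}. \<bar>f x\<bar>)"

definition adjoint_on ::
  "('a::real_normed_vector \<Rightarrow> 'v) \<Rightarrow> ('v \<Rightarrow> real) \<Rightarrow> ('a \<Rightarrow>\<^sub>L real)" where
  "adjoint_on T f = Blinfun (\<lambda>x. f (T x))"

definition dual_adjoint ::
  "('a::real_normed_vector \<Rightarrow>\<^sub>L 'b::real_normed_vector) \<Rightarrow> ('b \<Rightarrow>\<^sub>L real) \<Rightarrow> ('a \<Rightarrow>\<^sub>L real)" where
  "dual_adjoint T f = f o\<^sub>L T"

text \<open>The domain of an operator is given by its carrier and its norm, the codomain by its type.\<close>

definition strong_order_bounded ::
  "'x set \<Rightarrow> ('x \<Rightarrow> real) \<Rightarrow> ('x \<Rightarrow> 'f::order) \<Rightarrow> bool" where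
  "strong_order_bounded X N S \<longleftrightarrow>
     bdd_above (S ` {x \<in> X. N x \<le> 1}) \<and> bdd_below (S ` {x \<in> X. N x \<le> 1})"

definition disjoint_sequence :: "(nat \<Rightarrow> 'a::banach_lattice) \<Rightarrow> bool" where
  "disjoint_sequence x \<longleftrightarrow> (\<forall>m n. m \<noteq> n \<longrightarrow> inf \<bar>x m\<bar> \<bar>x n\<bar> = 0)"

definition M_weakly_compact :: "('v \<Rightarrow> real) \<Rightarrow> ('a::banach_lattice \<Rightarrow> 'v) \<Rightarrow> bool" where
  "M_weakly_compact N T \<longleftrightarrow>
     (\<forall>x. bounded (range x) \<and> disjoint_sequence x \<longrightarrow> (\<lambda>n. N (T (x n))) \<longlonglongrightarrow> 0)"

text \<open>\<open>nat\<close> carries the discrete topology, so bounded continuous functions on it, with the supremum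
  norm, are all bounded real sequences.\<close>

type_synonym l_infty = "nat \<Rightarrow>\<^sub>C real"

end

(* Both operator conditions are equivalent to: h (x n) tends to 0 for every positive functional h and
   every bounded disjoint sequence x. If the adjoint of T maps the unit ball into [l, h], then
   Hahn-Banach gives N (T x) <= (h - l) |x|, so the condition implies that T is M-weakly compact;
   conversely, the operators x |-> h x * v of rank one have strong order bounded adjoints.

   If the dual norm is order continuous, the components of h carried by the elements of a positive
   disjoint sequence form a series whose tails decrease to 0, hence tend to 0 in norm. Conversely,
   if h (x n) tends to 0 for all bounded disjoint x, then the unit ball is, up to a small value of h,
   contained in an order interval [-u, u]; on a directed set of functionals below h that decreases
   to 0, the norm is thus controlled by the value at the single point u. *)

theory Submission
  imports Defs
begin

subsection \<open>Banach lattices\<close>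

text \<open>Distributing \<open>+\<close> over \<open>inf\<close> turns
  \<open>inf x u + inf y u\<close> into the infimum of \<open>x + y\<close>, \<open>x + u\<close>,
  \<open>u + y\<close> and \<open>u + u\<close>. The last three dominate \<open>u\<close>, because
  all elements are positive.\<close>

lemma inf_add_le:
  fixes x y u :: "'a::lattice_ab_group_add"
  assumes "0 \<le> x" "0 \<le> y" "0 \<le> u"
  shows "inf (x + y) u \<le> inf x u + inf y u"
proof -
  have "inf (x + y) u \<le> inf (inf (x + y) (x + u)) (inf (u + y) (u + u))"
    using assms by (simp add: le_infI1 le_infI2 add_increasing add_increasing2)
  also have "\<dots> = inf x u + inf y u"
    by (simp add: add_inf_distrib_left add_inf_distrib_right inf_assoc inf_left_commute)
  finally show ?thesis .
qed

lemma disjoint_sum: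
  fixes u :: "'b \<Rightarrow> 'a::lattice_ab_group_add"
  assumes "finite F" "\<And>i. i \<in> F \<Longrightarrow> inf v (u i) = 0" "0 \<le> v" "\<And>i. i \<in> F \<Longrightarrow> 0 \<le> u i"
  shows "inf v (\<Sum>i\<in>F. u i) = 0"
  using assms
proof (induction F)
  case (insert j F)
  have "inf (u j + (\<Sum>i\<in>F. u i)) v \<le> inf (u j) v + inf (\<Sum>i\<in>F. u i) v"
    using insert by (intro inf_add_le) (auto intro: sum_nonneg)
  also have "\<dots> = 0" using insert by (simp add: inf_commute)
  finally have "inf v (\<Sum>i\<in>insert j F. u i) \<le> 0" using insert by (simp add: inf_commute)
  moreover have "0 \<le> inf v (\<Sum>i\<in>insert j F. u i)"
    using insert.prems by (auto intro!: sum_nonneg simp del: sum.insert)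
  ultimately show ?case by (rule order_antisym)
qed (auto simp: inf_absorb2)

text \<open>From \<open>a + b = inf a b + sup a b\<close>, the sum of two disjoint elements is their
  supremum, which stays below any common upper bound. By \<open>disjoint_sum\<close>, each new
  element is disjoint from the sum of the earlier ones.\<close>

lemma disjoint_sum_le:
  fixes a :: "'b \<Rightarrow> 'a::lattice_ab_group_add"
  assumes "finite F" "\<And>i j. i \<in> F \<Longrightarrow> j \<in> F \<Longrightarrow> i \<noteq> j \<Longrightarrow> inf (a i) (a j) = 0"
    "\<And>i. i \<in> F \<Longrightarrow> 0 \<le> a i" "\<And>i. i \<in> F \<Longrightarrow> a i \<le> x" "0 \<le> x"
  shows "(\<Sum>i\<in>F. a i) \<le> x"
  using assms
proof (induction F)
  case (insert j F)
  have "inf (a j) (\<Sum>i\<in>F. a i) = 0"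
  proof (rule disjoint_sum)
    show "inf (a j) (a i) = 0" if "i \<in> F" for i
      using that insert.hyps(2) by (intro insert.prems(1)) auto
    show "0 \<le> a i" if "i \<in> F" for i using that by (intro insert.prems(2)) simp
    show "0 \<le> a j" by (intro insert.prems(2)) simp
  qed (fact insert.hyps(1))
  then have "a j + (\<Sum>i\<in>F. a i) = sup (a j) (\<Sum>i\<in>F. a i)"
    using add_eq_inf_sup[of "a j" "\<Sum>i\<in>F. a i"] by simp
  also have "\<dots> \<le> x"
  proof (rule sup_least)
    show "(\<Sum>i\<in>F. a i) \<le> x" by (intro insert.IH insert.prems) auto
  qed (simp add: insert.prems)
  finally show ?case using insert.hyps by simp
qed simp

lemma disjoint_mono:
  fixes a b c d :: "'a::lattice_ab_group_add"
  assumes "inf c d = 0" "0 \<le> a" "a \<le> c" "0 \<le> b" "b \<le> d"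
  shows "inf a b = 0"
  using inf_mono[OF assms(3,5)] assms by (simp add: order_antisym)

lemma pprt_diff: "pprt z - pprt (- z) = (z :: 'a::lattice_ab_group_add)"
  using prts[of z] by (simp add: pprt_neg)

text \<open>Since \<open>pprt z = z + pprt (- z)\<close>, translating by \<open>pprt (- z)\<close>
  reduces the claim to \<open>inf z 0 = - pprt (- z)\<close>.\<close>

lemma pprt_disjoint:
  fixes z :: "'a::lattice_ab_group_add"
  shows "inf (pprt z) (pprt (- z)) = 0"
proof -
  have "inf (pprt z) (pprt (- z)) = inf (z + pprt (- z)) (0 + pprt (- z))"
    using pprt_diff[of z] by (simp add: diff_eq_eq)
  also have "\<dots> = nprt z + pprt (- z)"
    by (simp only: add_inf_distrib_right[symmetric] nprt_def)
  finally show ?thesis by (simp add: pprt_neg)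
qed

text \<open>Scaling by a positive number is monotone with monotone inverse, hence an order
  isomorphism; one inequality comes from \<open>c\<close>, the other from
  \<open>1 / c\<close>.\<close>

lemma inf_scaleR:
  fixes x y :: "'a::banach_lattice"
  assumes "0 < c"
  shows "inf (c *\<^sub>R x) (c *\<^sub>R y) = c *\<^sub>R inf x y"
proof (rule order_antisym)
  have "(1 / c) *\<^sub>R inf (c *\<^sub>R x) (c *\<^sub>R y) \<le> inf ((1 / c) *\<^sub>R (c *\<^sub>R x)) ((1 / c) *\<^sub>R (c *\<^sub>R y))"
    using assms by (intro le_infI scaleR_left_mono) auto
  then have "(1 / c) *\<^sub>R inf (c *\<^sub>R x) (c *\<^sub>R y) \<le> inf x y"
    using assms by simp
  from scaleR_left_mono[OF this, of c] show "inf (c *\<^sub>R x) (c *\<^sub>R y) \<le> c *\<^sub>R inf x y"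
    using assms by simp
  show "c *\<^sub>R inf x y \<le> inf (c *\<^sub>R x) (c *\<^sub>R y)"
    using assms by (intro le_infI scaleR_left_mono) auto
qed

lemma pprt_scaleR:
  fixes x :: "'a::banach_lattice"
  assumes "0 < c"
  shows "pprt (c *\<^sub>R x) = c *\<^sub>R pprt x"
  using inf_scaleR[OF assms, of "- x" 0]
  by (simp only: pprt_def sup_eq_neg_inf scaleR_minus_right scaleR_zero_right minus_zero)

lemma norm_mono:
  fixes x y :: "'a::banach_lattice"
  assumes "0 \<le> x" "x \<le> y"
  shows "norm x \<le> norm y"
proof (rule norm_mono_abs)
  show "\<bar>x\<bar> \<le> \<bar>y\<bar>" using assms order_trans[OF assms] by simp
qed

lemma norm_abs_eq: "norm \<bar>x\<bar> = norm (x :: 'a::banach_lattice)"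
  using norm_mono_abs[of "\<bar>x\<bar>" x] norm_mono_abs[of x "\<bar>x\<bar>"] by simp

lemma abs_eq_pprt: "\<bar>x :: 'a::lattice_ab_group_add_abs\<bar> = pprt x + pprt (- x)"
  by (simp add: abs_prts pprt_neg)

lemma norm_pprt_le: "norm (pprt x) \<le> norm (x :: 'a::banach_lattice)"
proof -
  have "norm (pprt x) \<le> norm \<bar>x\<bar>"
    by (rule norm_mono) (simp_all add: abs_eq_pprt)
  then show ?thesis by (simp add: norm_abs_eq)
qed

text \<open>The distance to positive elements controls the negative part of the limit: if
  \<open>0 \<le> x n\<close>, then \<open>- l \<le> \<bar>x n - l\<bar>\<close>, so
  \<open>pprt (- l)\<close> has norm at most \<open>norm (x n - l)\<close>, which tends to
  0.\<close>

lemma tendsto_cone_nonneg: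
  fixes x :: "nat \<Rightarrow> 'a::banach_lattice"
  assumes "x \<longlonglongrightarrow> l" "\<forall>\<^sub>F n in sequentially. 0 \<le> x n"
  shows "0 \<le> l"
proof -
  have "\<forall>\<^sub>F n in sequentially. norm (pprt (- l)) \<le> norm (x n - l)"
    using assms(2)
  proof eventually_elim
    case (elim n)
    then have "- l \<le> \<bar>x n - l\<bar>"
      using abs_ge_self[of "x n - l"] by (smt (verit) add_increasing diff_conv_add_uminus order_trans order_refl)
    then have "pprt (- l) \<le> \<bar>x n - l\<bar>" by (simp add: pprt_def)
    then have "norm (pprt (- l)) \<le> norm \<bar>x n - l\<bar>" by (intro norm_mono) simp_all
    then show ?case by (simp add: norm_abs_eq)
  qed
  moreover have "(\<lambda>n. norm (x n - l)) \<longlonglongrightarrow> 0"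
    using assms(1) by (simp add: LIM_zero tendsto_norm_zero)
  ultimately have "norm (pprt (- l)) \<le> 0"
    by (intro tendsto_lowerbound[of _ _ sequentially]) auto
  then show ?thesis by (simp add: le_zero_iff_zero_pprt[symmetric])
qed

lemma term_le_sums_cone:
  fixes x :: "nat \<Rightarrow> 'a::banach_lattice"
  assumes "x sums s" "\<And>n. 0 \<le> x n"
  shows "x k \<le> s"
proof -
  have "(\<lambda>n. (\<Sum>i<n. x i) - x k) \<longlonglongrightarrow> s - x k"
    using assms(1) by (intro tendsto_diff tendsto_const) (simp add: sums_def)
  moreover have "\<forall>\<^sub>F n in sequentially. 0 \<le> (\<Sum>i<n. x i) - x k"
    using eventually_gt_at_top[of k]
  proof eventually_elim
    case (elim n)
    then have "sum x {k} \<le> (\<Sum>i<n. x i)" using assms(2) by (intro sum_mono2) auto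
    then show ?case by simp
  qed
  ultimately have "0 \<le> s - x k" by (rule tendsto_cone_nonneg)
  then show ?thesis by simp
qed

subsection \<open>Positive functionals\<close>

lemma blinfun_nonneg_iff: "0 \<le> (h :: 'a::banach_lattice \<Rightarrow>\<^sub>L real) \<longleftrightarrow> (\<forall>x\<ge>0. 0 \<le> h x)"
  by (simp add: less_eq_blinfun_def)

lemma blinfun_mono:
  fixes h :: "'a::banach_lattice \<Rightarrow>\<^sub>L real"
  assumes "0 \<le> h" "x \<le> y"
  shows "h x \<le> h y"
proof -
  have "0 \<le> h (y - x)" using assms by (simp add: blinfun_nonneg_iff)
  then show ?thesis by (simp add: blinfun.diff_right)
qed

lemma abs_blinfun_le:
  fixes h :: "'a::banach_lattice \<Rightarrow>\<^sub>L real"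
  assumes "0 \<le> h"
  shows "\<bar>h x\<bar> \<le> h \<bar>x\<bar>"
  using blinfun_mono[OF assms abs_ge_self, of x] blinfun_mono[OF assms abs_ge_minus_self, of x]
  by (simp add: blinfun.minus_right)

text \<open>Positive vectors suffice to test the norm of a positive functional, because
  \<open>\<bar>h x\<bar> \<le> h \<bar>x\<bar>\<close> and \<open>\<bar>x\<bar>\<close> has the norm
  of \<open>x\<close>.\<close>

lemma blinfun_norm_le_cone:
  fixes h :: "'a::banach_lattice \<Rightarrow>\<^sub>L real"
  assumes "0 \<le> h" "0 \<le> e" "\<And>x. 0 \<le> x \<Longrightarrow> norm x \<le> 1 \<Longrightarrow> h x \<le> e"
  shows "norm h \<le> e"
proof (rule norm_blinfun_bound[OF assms(2)])
  fix x
  show "norm (h x) \<le> e * norm x"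
  proof (cases "x = 0")
    case False
    define z where "z = (1 / norm x) *\<^sub>R \<bar>x\<bar>"
    have "0 \<le> z" by (simp add: z_def scaleR_nonneg_nonneg)
    moreover have "norm z \<le> 1" by (simp add: z_def norm_abs_eq)
    ultimately have "h z \<le> e" by (rule assms(3))
    then have "h \<bar>x\<bar> \<le> e * norm x"
      using False by (simp add: z_def blinfun.scaleR_right divide_le_eq)
    then show ?thesis using abs_blinfun_le[OF assms(1), of x] by simp
  qed simp
qed

lemma blinfun_norm_mono:
  fixes g h :: "'a::banach_lattice \<Rightarrow>\<^sub>L real"
  assumes "0 \<le> g" "g \<le> h"
  shows "norm g \<le> norm h"
proof (rule blinfun_norm_le_cone[OF assms(1)])
  fix x :: 'a assume x: "0 \<le> x" "norm x \<le> 1"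
  have "g x \<le> h x" using assms(2) x by (simp add: less_eq_blinfun_def)
  also have "\<dots> \<le> norm h * norm x" using norm_blinfun[of h x] by simp
  also have "\<dots> \<le> norm h" using x by (simp add: mult_left_le)
  finally show "g x \<le> norm h" .
qed simp

section \<open>Extension of additive functions from the positive cone\<close>

text \<open>Additivity gives homogeneity for integer factors. For real \<open>c\<close>, splitting
  \<open>real n * c\<close> into an integer and a remainder in [0, 1] bounds \<open>n\<close> times
  the defect \<open>\<delta>\<close> of homogeneity independently of \<open>n\<close>, so
  \<open>\<delta> = 0\<close>.\<close>

lemma additive_bounded_imp_bounded_linear:
  fixes g :: "'a::real_normed_vector \<Rightarrow> real"
  assumes add: "\<And>x y. g (x + y) = g x + g y" and bound: "\<And>x. \<bar>g x\<bar> \<le> C * norm x"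
  shows "bounded_linear g"
proof (rule bounded_linear_intro[where K = C])
  have zero: "g 0 = 0" using add[of 0 0] by simp
  have nat: "g (real n *\<^sub>R x) = real n * g x" for n x
    by (induction n) (simp_all add: zero add scaleR_left_distrib algebra_simps)
  have minus: "g (- x) = - g x" for x using add[of x "- x"] zero by simp
  have int: "g (of_int k *\<^sub>R x) = of_int k * g x" for k :: int and x
    by (cases k) (simp_all only: of_int_of_nat_eq of_int_minus scaleR_minus_left minus nat mult_minus_left)
  show "g (c *\<^sub>R x) = c *\<^sub>R g x" for c x
  proof -
    define \<delta> where "\<delta> = g (c *\<^sub>R x) - c * g x"
    have C: "0 \<le> C * norm x" using bound[of x] by linarith
    have "real n * \<bar>\<delta>\<bar> \<le> C * norm x + \<bar>g x\<bar>" for n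
    proof -
      define r where "r = real n * c - of_int \<lfloor>real n * c\<rfloor>"
      have r: "0 \<le> r" "r \<le> 1" unfolding r_def by linarith+
      have "real n *\<^sub>R (c *\<^sub>R x) = r *\<^sub>R x + of_int \<lfloor>real n * c\<rfloor> *\<^sub>R x"
        by (simp add: r_def scaleR_left_distrib[symmetric])
      then have "real n * g (c *\<^sub>R x) = g (r *\<^sub>R x) + of_int \<lfloor>real n * c\<rfloor> * g x"
        by (metis add nat int)
      then have "real n * \<delta> = g (r *\<^sub>R x) - r * g x"
        by (simp add: \<delta>_def r_def algebra_simps)
      then have "real n * \<bar>\<delta>\<bar> = \<bar>g (r *\<^sub>R x) - r * g x\<bar>"
        by (metis abs_mult abs_of_nat)
      also have "\<dots> \<le> \<bar>g (r *\<^sub>R x)\<bar> + \<bar>r * g x\<bar>" by linarith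
      also have "\<bar>g (r *\<^sub>R x)\<bar> \<le> r * (C * norm x)"
        using bound[of "r *\<^sub>R x"] r by (simp add: mult.left_commute)
      also have "r * (C * norm x) \<le> C * norm x" using r C by (simp add: mult_left_le_one_le)
      also have "\<bar>r * g x\<bar> \<le> \<bar>g x\<bar>" using r by (simp add: abs_mult mult_left_le_one_le)
      finally show ?thesis by simp
    qed
    then have "\<delta> = 0"
      using real_archimedian_rdiv_eq_0[of "\<bar>\<delta>\<bar>" "C * norm x + \<bar>g x\<bar>"] C by auto
    then show ?thesis by (simp add: \<delta>_def)
  qed
  show "norm (g x) \<le> norm x * C" for x using bound[of x] by (simp add: mult.commute)
qed (rule add)

text \<open>This produces functionals from formulas that are additive on positive arguments only,
  such as pointwise series and infima of positive functionals.\<close>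

lemma cone_extension:
  fixes \<phi> :: "'a::banach_lattice \<Rightarrow> real"
  assumes add: "\<And>x y. 0 \<le> x \<Longrightarrow> 0 \<le> y \<Longrightarrow> \<phi> (x + y) = \<phi> x + \<phi> y"
    and bound: "\<And>x. 0 \<le> x \<Longrightarrow> \<bar>\<phi> x\<bar> \<le> C * norm x"
  obtains g :: "'a \<Rightarrow>\<^sub>L real" where "\<And>x. 0 \<le> x \<Longrightarrow> g x = \<phi> x"
proof -
  define g where "g = (\<lambda>x. \<phi> (pprt x) - \<phi> (pprt (- x)))"
  \<comment> \<open>The value of \<open>g\<close> does not depend on how its argument is written as
    a difference of positive elements. Additivity of \<open>g\<close> follows by adding two such
    decompositions.\<close>
  have g_diff: "g (a - b) = \<phi> a - \<phi> b" if "0 \<le> a" "0 \<le> b" for a b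
  proof -
    have "a + pprt (- (a - b)) = pprt (a - b) + b"
      using pprt_diff[of "a - b"] by (metis add.commute diff_add_cancel diff_diff_eq2 diff_eq_eq)
    then have "\<phi> a + \<phi> (pprt (- (a - b))) = \<phi> (pprt (a - b)) + \<phi> b"
      using that by (metis add zero_le_pprt)
    then show ?thesis by (simp add: g_def)
  qed
  have "bounded_linear g"
  proof (rule additive_bounded_imp_bounded_linear)
    fix x y :: 'a
    have "x + y = (pprt x + pprt y) - (pprt (- x) + pprt (- y))"
      by (simp only: add_diff_add pprt_diff)
    then have "g (x + y) = \<phi> (pprt x + pprt y) - \<phi> (pprt (- x) + pprt (- y))"
      using g_diff[of "pprt x + pprt y" "pprt (- x) + pprt (- y)"] by simp
    then show "g (x + y) = g x + g y" by (simp add: add g_def)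
  next
    fix x
    have b: "\<bar>\<phi> (pprt z)\<bar> \<le> \<bar>C\<bar> * norm z" for z
    proof -
      have "\<bar>\<phi> (pprt z)\<bar> \<le> \<bar>C\<bar> * norm (pprt z)"
        using bound[of "pprt z"] by (smt (verit) mult_right_mono norm_ge_zero zero_le_pprt)
      also have "\<dots> \<le> \<bar>C\<bar> * norm z" by (intro mult_left_mono norm_pprt_le) simp
      finally show ?thesis .
    qed
    show "\<bar>g x\<bar> \<le> (2 * \<bar>C\<bar>) * norm x"
      using b[of x] b[of "- x"] unfolding g_def by simp
  qed
  moreover have "g x = \<phi> x" if "0 \<le> x" for x
    using g_diff[of x 0] add[of 0 0] that by simp
  ultimately show ?thesis
    using that[of "Blinfun g"] by (simp add: bounded_linear_Blinfun_apply)
qed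

subsection \<open>The Hahn--Banach theorem\<close>

text \<open>Homogeneity is required as an inequality only, which is what passes easily to infima;
  for \<open>c > 0\<close> the reverse inequality results from the factor
  \<open>1 / c\<close>.\<close>

definition sublinear :: "('v::real_vector \<Rightarrow> real) \<Rightarrow> bool" where
  "sublinear p \<longleftrightarrow> (\<forall>x y. p (x + y) \<le> p x + p y) \<and> (\<forall>c\<ge>0. \<forall>x. p (c *\<^sub>R x) \<le> c * p x)"

lemma sublinear_add: "sublinear p \<Longrightarrow> p (x + y) \<le> p x + p y"
  and sublinear_scaleR: "sublinear p \<Longrightarrow> 0 \<le> c \<Longrightarrow> p (c *\<^sub>R x) \<le> c * p x"
  by (simp_all add: sublinear_def)

lemma sublinear_0: "sublinear p \<Longrightarrow> p 0 = 0"
  using sublinear_add[of p 0 0] sublinear_scaleR[of p 0 0] by simp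

lemma sublinear_scaleR_eq:
  assumes "sublinear p" "0 \<le> c"
  shows "p (c *\<^sub>R x) = c * p x"
proof (cases "c = 0")
  case False
  then have "c * p ((1 / c) *\<^sub>R (c *\<^sub>R x)) \<le> c * ((1 / c) * p (c *\<^sub>R x))"
    using assms by (intro mult_left_mono sublinear_scaleR) auto
  then have "c * p x \<le> p (c *\<^sub>R x)" using False by simp
  then show ?thesis using sublinear_scaleR[OF assms, of x] by simp
qed (simp add: sublinear_0[OF assms(1)])

lemma sublinear_minus: "sublinear p \<Longrightarrow> - p (- x) \<le> p x"
  using sublinear_add[of p x "- x"] sublinear_0[of p] by simp

text \<open>For sublinear \<open>p\<close> this is a smaller sublinear functional that is linear
  along \<open>y\<close>: \<open>t = 0\<close> bounds it by \<open>p\<close>, and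
  \<open>t = 1\<close> bounds its value at \<open>- y\<close> by \<open>- p y\<close>.\<close>

definition directional_inf :: "('v::real_vector \<Rightarrow> real) \<Rightarrow> 'v \<Rightarrow> 'v \<Rightarrow> real" where
  "directional_inf p y x = (INF t\<in>{0..}. p (x + t *\<^sub>R y) - t * p y)"

lemma directional_inf_le:
  assumes "sublinear p" "0 \<le> t"
  shows "directional_inf p y x \<le> p (x + t *\<^sub>R y) - t * p y"
  unfolding directional_inf_def
proof (rule cINF_lower)
  \<comment> \<open>The bound \<open>- p (- x)\<close> is uniform in \<open>t\<close>, so the
    infimum is a genuine one.\<close>
  show "bdd_below ((\<lambda>t. p (x + t *\<^sub>R y) - t * p y) ` {0..})"
  proof (rule bdd_belowI2)
    fix t :: real assume "t \<in> {0..}"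
    then have "t * p y = p (t *\<^sub>R y)" using assms by (simp add: sublinear_scaleR_eq)
    also have "\<dots> \<le> p (x + t *\<^sub>R y) + p (- x)"
      using sublinear_add[OF assms(1), of "x + t *\<^sub>R y" "- x"] by simp
    finally show "- p (- x) \<le> p (x + t *\<^sub>R y) - t * p y" by simp
  qed
qed (use assms in auto)

lemma directional_inf_greatest:
  "(\<And>t. 0 \<le> t \<Longrightarrow> m \<le> p (x + t *\<^sub>R y) - t * p y) \<Longrightarrow> m \<le> directional_inf p y x"
  unfolding directional_inf_def by (rule cINF_greatest) auto

lemma sublinear_directional_inf:
  assumes p: "sublinear p"
  shows "sublinear (directional_inf p y)"
  unfolding sublinear_def
proof safe
  fix x1 x2
  \<comment> \<open>Parameters \<open>s\<close> and \<open>t\<close> chosen independently for the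
    two summands combine to \<open>s + t\<close>; the infima over \<open>t\<close> and over
    \<open>s\<close> are then taken one after the other.\<close>
  have *: "directional_inf p y (x1 + x2) \<le>
      (p (x1 + s *\<^sub>R y) - s * p y) + (p (x2 + t *\<^sub>R y) - t * p y)" if "0 \<le> s" "0 \<le> t" for s t
  proof -
    have "directional_inf p y (x1 + x2) \<le> p ((x1 + x2) + (s + t) *\<^sub>R y) - (s + t) * p y"
      using that by (intro directional_inf_le p) simp
    also have "(x1 + x2) + (s + t) *\<^sub>R y = (x1 + s *\<^sub>R y) + (x2 + t *\<^sub>R y)"
      by (simp add: algebra_simps)
    finally show ?thesis
      using sublinear_add[OF p, of "x1 + s *\<^sub>R y" "x2 + t *\<^sub>R y"] by (simp add: algebra_simps)
  qed
  have "directional_inf p y (x1 + x2) - (p (x1 + s *\<^sub>R y) - s * p y) \<le> directional_inf p y x2"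
    if "0 \<le> s" for s
    by (rule directional_inf_greatest) (use *[OF that] in \<open>simp add: algebra_simps\<close>)
  then have "directional_inf p y (x1 + x2) - directional_inf p y x2 \<le> directional_inf p y x1"
    by (intro directional_inf_greatest) (simp add: algebra_simps)
  then show "directional_inf p y (x1 + x2) \<le> directional_inf p y x1 + directional_inf p y x2"
    by simp
next
  fix c :: real and x assume "0 \<le> c"
  show "directional_inf p y (c *\<^sub>R x) \<le> c * directional_inf p y x"
  proof (cases "c = 0")
    case True
    then show ?thesis using directional_inf_le[OF p, of 0 y 0] by (simp add: sublinear_0[OF p])
  next
    case False
    with \<open>0 \<le> c\<close> have c: "0 < c" by simp
    have "directional_inf p y (c *\<^sub>R x) / c \<le> directional_inf p y x"
    proof (rule directional_inf_greatest)
      fix t :: real assume t: "0 \<le> t"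
      \<comment> \<open>The parameter \<open>t\<close> for \<open>x\<close> corresponds to
        \<open>c * t\<close> for the scaled vector.\<close>
      have "directional_inf p y (c *\<^sub>R x) \<le> p (c *\<^sub>R x + (c * t) *\<^sub>R y) - (c * t) * p y"
        using t c by (intro directional_inf_le p) simp
      also have "c *\<^sub>R x + (c * t) *\<^sub>R y = c *\<^sub>R (x + t *\<^sub>R y)"
        by (simp add: scaleR_right_distrib)
      also have "p \<dots> = c * p (x + t *\<^sub>R y)"
        using c by (intro sublinear_scaleR_eq p) simp
      finally show "directional_inf p y (c *\<^sub>R x) / c \<le> p (x + t *\<^sub>R y) - t * p y"
        using c by (simp add: pos_divide_le_eq right_diff_distrib mult.commute mult.left_commute)
    qed
    then show ?thesis using c by (simp add: divide_le_eq mult.commute)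
  qed
qed

text \<open>The chain condition serves subadditivity: the smaller one \<open>r\<close> of
  \<open>p\<close> and \<open>q\<close> satisfies
  \<open>r (x + y) \<le> r x + r y \<le> p x + q y\<close>.\<close>

lemma sublinear_INF_chain:
  assumes C: "C \<noteq> {}" "\<And>p. p \<in> C \<Longrightarrow> sublinear p"
    and chain: "\<And>p q. p \<in> C \<Longrightarrow> q \<in> C \<Longrightarrow> p \<le> q \<or> q \<le> p"
    and bdd: "\<And>x. bdd_below ((\<lambda>p. p x) ` C)"
  shows "sublinear (\<lambda>x. INF p\<in>C. p x)"
  unfolding sublinear_def
proof safe
  let ?m = "\<lambda>x. INF p\<in>C. p x"
  have lower: "?m x \<le> p x" if "p \<in> C" for p x
    using that bdd by (intro cINF_lower)
  {
    fix x y
    have *: "?m (x + y) \<le> p x + q y" if pq: "p \<in> C" "q \<in> C" for p q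
    proof -
      obtain r where "r \<in> C" "r \<le> p" "r \<le> q" using chain[OF pq] pq by blast
      then show ?thesis
        using lower[of r "x + y"] sublinear_add[OF C(2), of r x y] le_funD[of r p x] le_funD[of r q y]
        by simp
    qed
    have "?m (x + y) - p x \<le> ?m y" if "p \<in> C" for p
      by (rule cINF_greatest[OF C(1)]) (use *[OF that] in \<open>simp add: algebra_simps\<close>)
    then have "?m (x + y) - ?m y \<le> ?m x"
      by (intro cINF_greatest[OF C(1)]) (simp add: algebra_simps)
    then show "?m (x + y) \<le> ?m x + ?m y" by simp
  next
    fix c :: real and x assume c: "0 \<le> c"
    show "?m (c *\<^sub>R x) \<le> c * ?m x"
    proof (cases "c = 0")
      case True
      then show ?thesis using C by (simp add: sublinear_0 cong: INF_cong)
    next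
      case False
      have "?m (c *\<^sub>R x) / c \<le> ?m x"
      proof (rule cINF_greatest[OF C(1)])
        fix p assume "p \<in> C"
        then show "?m (c *\<^sub>R x) / c \<le> p x"
          using lower[of p "c *\<^sub>R x"] sublinear_scaleR[OF C(2), of p c x] c False
          by (simp add: divide_le_eq mult.commute)
      qed
      then show ?thesis using c False by (simp add: divide_le_eq mult.commute)
    qed
  }
qed

text \<open>A minimal sublinear functional \<open>p\<close> satisfies \<open>directional_inf p y = p\<close>; evaluating the
  infimum at \<open>t = 1\<close> shows that \<open>p\<close> is superadditive as well.\<close>

lemma sublinear_dominates_linear:
  fixes q :: "'v::real_vector \<Rightarrow> real"
  assumes q: "sublinear q"
  obtains f where "linear f" "f \<le> q"
proof -
  let ?A = "{p. sublinear p \<and> p \<le> q}"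
  have "\<exists>m\<in>?A. \<forall>a\<in>?A. a \<le> m \<longrightarrow> a = m"
  \<comment> \<open>Zorn's lemma is applied to the reversed order, so its maximal element is a
    minimal sublinear functional below \<open>q\<close>.\<close>
  proof (rule predicate_Zorn)
    show "partial_order_on ?A (relation_of (\<lambda>x y. y \<le> x) ?A)"
      by (rule partial_order_on_relation_ofI) auto
  next
    fix C assume C: "C \<in> Chains (relation_of (\<lambda>x y. y \<le> x) ?A)"
    then have sub: "C \<subseteq> ?A" by (rule Chains_relation_of)
    show "\<exists>u\<in>?A. \<forall>a\<in>C. u \<le> a"
    proof (cases "C = {}")
      case False
      have bdd: "bdd_below ((\<lambda>p. p x) ` C)" for x
      proof (rule bdd_belowI2)
        fix p assume "p \<in> C"
        then have "sublinear p" "p (- x) \<le> q (- x)" using sub by (auto simp: le_fun_def)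
        then show "- q (- x) \<le> p x" using sublinear_minus[of p x] by linarith
      qed
      let ?m = "\<lambda>x. INF p\<in>C. p x"
      have "sublinear ?m"
        by (rule sublinear_INF_chain) (use False sub C bdd in \<open>auto simp: Chains_def relation_of_def\<close>)
      moreover have low: "?m \<le> p" if "p \<in> C" for p
        using that bdd by (intro le_funI cINF_lower)
      moreover have "?m \<le> q" using low False sub by (blast intro: order_trans)
      ultimately show ?thesis by blast
    qed (use q in auto)
  qed
  then obtain p where p: "sublinear p" "p \<le> q"
    and minimal: "\<And>r. sublinear r \<Longrightarrow> r \<le> q \<Longrightarrow> r \<le> p \<Longrightarrow> r = p"
    by blast
  have superadd: "p x + p y \<le> p (x + y)" for x y
  proof -
    have "directional_inf p y \<le> p"
      using directional_inf_le[OF p(1), of 0 y] by (simp add: le_fun_def)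
    then have "directional_inf p y = p"
      using p by (intro minimal sublinear_directional_inf) (blast intro: order_trans)+
    then show ?thesis using directional_inf_le[OF p(1), of 1 y x] by simp
  qed
  have add: "p (x + y) = p x + p y" for x y
    using superadd sublinear_add[OF p(1)] by (simp add: order_antisym)
  have minus: "p (- x) = - p x" for x
    using add[of x "- x"] sublinear_0[OF p(1)] by simp
  have "linear p"
  proof (rule linearI)
    fix c :: real and x
    show "p (c *\<^sub>R x) = c *\<^sub>R p x"
    proof (cases "0 \<le> c")
      case False
      then show ?thesis
        using sublinear_scaleR_eq[OF p(1), of "- c" x] minus[of "c *\<^sub>R x"] by simp
    qed (simp add: sublinear_scaleR_eq p)
  qed (rule add)
  then show ?thesis using p(2) that by blast
qed

text \<open>A linear functional below \<open>directional_inf q y\<close> is at most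
  \<open>- q y\<close> at \<open>- y\<close>, hence at least \<open>q y\<close> at
  \<open>y\<close>.\<close>

lemma Hahn_Banach_point:
  fixes q :: "'v::real_vector \<Rightarrow> real"
  assumes q: "sublinear q"
  obtains f where "linear f" "f \<le> q" "f y = q y"
proof -
  obtain f where f: "linear f" "f \<le> directional_inf q y"
    using sublinear_dominates_linear[OF sublinear_directional_inf[OF q]] .
  have "directional_inf q y \<le> q"
    using directional_inf_le[OF q, of 0 y] by (simp add: le_fun_def)
  with f have fq: "f \<le> q" by (blast intro: order_trans)
  have "f (- y) \<le> - q y"
    using le_funD[OF f(2), of "- y"] directional_inf_le[OF q, of 1 y "- y"] sublinear_0[OF q]
    by simp
  then have "q y \<le> f y" using f(1) by (simp add: linear_neg)
  then have "f y = q y" using fq by (simp add: le_fun_def order_antisym)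
  then show ?thesis using that f(1) fq by blast
qed

text \<open>Nothing is known about \<open>N\<close> outside \<open>V\<close>, so a linear projection
  \<open>P\<close> onto \<open>V\<close> first makes \<open>N (P x)\<close> a sublinear functional
  on the whole type. The functional obtained from it is then set to 0 outside \<open>V\<close>, as
  membership in \<open>dual_on\<close> demands.\<close>

lemma norming_functional_on:
  assumes VN: "banach_space_on V N" and y: "y \<in> V"
  obtains f where "f \<in> dual_on V N" "dual_norm_on V N f \<le> 1" "f y = N y"
proof -
  have V: "subspace V" using VN by (simp add: banach_space_on_def)
  have scale: "N (c *\<^sub>R x) = \<bar>c\<bar> * N x" and triangle: "N (x + z) \<le> N x + N z"
    if "x \<in> V" "z \<in> V" for x z c
    using VN that by (auto simp: banach_space_on_def)
  obtain P where P: "range P \<subseteq> V" "linear P" "\<And>v. v \<in> V \<Longrightarrow> P v = v"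
    using linear_exists_left_inverse_on[of "\<lambda>x. x" V] V by (auto simp: linear_ident)
  have PV: "P x \<in> V" for x using P(1) by blast
  have "sublinear (\<lambda>x. N (P x))"
    unfolding sublinear_def
    using scale[OF PV PV] triangle[OF PV PV] P(2) by (auto simp: linear_add linear_scale)
  then obtain g where g: "linear g" "g \<le> (\<lambda>x. N (P x))" "g y = N (P y)"
    by (rule Hahn_Banach_point)
  have bound: "\<bar>g x\<bar> \<le> N x" if "x \<in> V" for x
  proof -
    have "g x \<le> N x" using g(2) P(3)[OF that] by (metis le_funD)
    moreover have "g (- x) \<le> N (- x)" using g(2) P(3)[of "- x"] V that by (metis le_funD subspace_neg)
    moreover have "N (- x) = N x" using scale[OF that that, of "- 1"] by simp
    ultimately show ?thesis using g(1) by (simp add: linear_neg)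
  qed
  define f where "f = (\<lambda>x. if x \<in> V then g x else 0)"
  have "f \<in> dual_on V N"
    unfolding dual_on_def f_def
    using V g(1) bound
    by (auto simp: subspace_add subspace_scale linear_add linear_scale intro!: exI[of _ 1])
  moreover have "dual_norm_on V N f \<le> 1"
    unfolding dual_norm_on_def
  proof (rule cSUP_least)
    have "N 0 = 0" using VN subspace_0[OF V] by (simp add: banach_space_on_def)
    then show "{x \<in> V. N x \<le> 1} \<noteq> {}" using subspace_0[OF V] by force
  qed (use bound in \<open>force simp: f_def\<close>)
  moreover have "f y = N y" using g(3) y P(3) by (simp add: f_def)
  ultimately show ?thesis by (rule that)
qed

subsection \<open>Order continuity of the dual norm\<close>

text \<open>The component of the positive functional \<open>h\<close> carried by the element \<open>u\<close>; meaningful on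
  positive arguments only.\<close>

definition band_part :: "('a::banach_lattice \<Rightarrow>\<^sub>L real) \<Rightarrow> 'a \<Rightarrow> 'a \<Rightarrow> real" where
  "band_part h u x = (SUP k::nat. h (inf x (real k *\<^sub>R u)))"

context
  fixes h :: "'a::banach_lattice \<Rightarrow>\<^sub>L real"
  assumes h: "0 \<le> h"
begin

lemma bdd_above_band_part: "bdd_above (range (\<lambda>k::nat. h (inf x (real k *\<^sub>R u))))"
  by (rule bdd_aboveI2[where M = "h x"]) (simp add: blinfun_mono[OF h])

lemma band_part_upper: "h (inf x (real k *\<^sub>R u)) \<le> band_part h u x"
  unfolding band_part_def by (rule cSUP_upper[OF UNIV_I bdd_above_band_part])

lemma LIMSEQ_band_part:
  assumes "0 \<le> u"
  shows "(\<lambda>k. h (inf x (real k *\<^sub>R u))) \<longlonglongrightarrow> band_part h u x"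
  unfolding band_part_def
proof (rule LIMSEQ_incseq_SUP[OF bdd_above_band_part])
  show "incseq (\<lambda>k. h (inf x (real k *\<^sub>R u)))"
    using assms by (intro incseq_SucI blinfun_mono[OF h] inf_mono scaleR_right_mono) auto
qed

lemma band_part_nonneg:
  assumes "0 \<le> x"
  shows "0 \<le> band_part h u x"
  using band_part_upper[of x 0 u] assms by (simp add: inf_absorb2)

lemma band_part_self: "h u \<le> band_part h u u"
  using band_part_upper[of u 1 u] by simp

text \<open>Subadditivity is \<open>inf_add_le\<close>. Conversely, the truncations of
  \<open>x\<close> and \<open>y\<close> at \<open>k\<close> times \<open>u\<close> add up to an
  element below the truncation of \<open>x + y\<close> at \<open>2 * k\<close> times
  \<open>u\<close>, and \<open>k\<close> tends to infinity.\<close>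

lemma band_part_add:
  assumes "0 \<le> u" "0 \<le> x" "0 \<le> y"
  shows "band_part h u (x + y) = band_part h u x + band_part h u y"
proof (rule antisym)
  show "band_part h u (x + y) \<le> band_part h u x + band_part h u y"
    unfolding band_part_def[of h u "x + y"]
  proof (rule cSUP_least)
    fix k :: nat
    have "h (inf (x + y) (real k *\<^sub>R u)) \<le> h (inf x (real k *\<^sub>R u) + inf y (real k *\<^sub>R u))"
      using assms by (intro blinfun_mono[OF h] inf_add_le) (auto simp: scaleR_nonneg_nonneg)
    then show "h (inf (x + y) (real k *\<^sub>R u)) \<le> band_part h u x + band_part h u y"
      using band_part_upper[of x k u] band_part_upper[of y k u] by (simp add: blinfun.add_right)
  qed simp
  show "band_part h u x + band_part h u y \<le> band_part h u (x + y)"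
  proof (rule LIMSEQ_le_const2)
    show "(\<lambda>k. h (inf x (real k *\<^sub>R u)) + h (inf y (real k *\<^sub>R u)))
        \<longlonglongrightarrow> band_part h u x + band_part h u y"
      using assms by (intro tendsto_add LIMSEQ_band_part)
    have "h (inf x (real k *\<^sub>R u)) + h (inf y (real k *\<^sub>R u)) \<le> band_part h u (x + y)" for k
    proof -
      have "real (2 * k) *\<^sub>R u = real k *\<^sub>R u + real k *\<^sub>R u"
        by (simp add: scaleR_left_distrib[symmetric])
      then have "inf x (real k *\<^sub>R u) + inf y (real k *\<^sub>R u) \<le> inf (x + y) (real (2 * k) *\<^sub>R u)"
        by (simp only: le_inf_iff) (intro conjI add_mono inf_le1 inf_le2)
      then have "h (inf x (real k *\<^sub>R u) + inf y (real k *\<^sub>R u)) \<le> h (inf (x + y) (real (2 * k) *\<^sub>R u))"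
        by (rule blinfun_mono[OF h])
      also have "\<dots> \<le> band_part h u (x + y)" by (rule band_part_upper)
      finally show ?thesis by (simp add: blinfun.add_right)
    qed
    then show "\<exists>N. \<forall>k\<ge>N. h (inf x (real k *\<^sub>R u)) + h (inf y (real k *\<^sub>R u)) \<le> band_part h u (x + y)"
      by blast
  qed
qed

text \<open>For fixed \<open>k\<close> the truncations of \<open>x\<close> at the multiples of the
  \<open>u i\<close> are disjoint and lie below \<open>x\<close>, and so does their sum. It remains
  to apply \<open>h\<close> and let \<open>k\<close> tend to infinity.\<close>

lemma sum_band_part_le:
  assumes u: "\<And>i. 0 \<le> u i" "\<And>i j. i \<noteq> j \<Longrightarrow> inf (u i) (u j) = 0" and "finite F" "0 \<le> x"
  shows "(\<Sum>i\<in>F. band_part h (u i) x) \<le> h x"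
proof (rule LIMSEQ_le_const2)
  show "(\<lambda>k. \<Sum>i\<in>F. h (inf x (real k *\<^sub>R u i))) \<longlonglongrightarrow> (\<Sum>i\<in>F. band_part h (u i) x)"
    by (intro tendsto_sum LIMSEQ_band_part u)
  have "(\<Sum>i\<in>F. h (inf x (real k *\<^sub>R u i))) \<le> h x" for k
  proof -
    have disj: "inf (inf x (real k *\<^sub>R u i)) (inf x (real k *\<^sub>R u j)) = 0" if "i \<noteq> j" for i j
    proof (rule disjoint_mono)
      show "inf (real k *\<^sub>R u i) (real k *\<^sub>R u j) = 0"
        using that by (cases "k = 0") (simp_all add: inf_scaleR u(2))
    qed (use \<open>0 \<le> x\<close> u(1) in \<open>simp_all add: scaleR_nonneg_nonneg\<close>)
    have "(\<Sum>i\<in>F. inf x (real k *\<^sub>R u i)) \<le> x"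
      by (rule disjoint_sum_le)
        (use disj \<open>finite F\<close> \<open>0 \<le> x\<close> u(1) in \<open>simp_all add: scaleR_nonneg_nonneg\<close>)
    from blinfun_mono[OF h this] show ?thesis by (simp add: blinfun.sum_right)
  qed
  then show "\<exists>N. \<forall>k\<ge>N. (\<Sum>i\<in>F. h (inf x (real k *\<^sub>R u i))) \<le> h x" by blast
qed

text \<open>The functionals \<open>t n = (\<Sum>i\<ge>n. band_part h (u i))\<close> decrease to \<open>0\<close> pointwise, hence in norm,
  while \<open>h (u n) \<le> t n (u n)\<close>.\<close>

lemma order_continuous_dual_imp_tendsto_0:
  assumes oc: "order_continuous_norm TYPE('a \<Rightarrow>\<^sub>L real)"
    and u: "\<And>n. 0 \<le> u n" "\<And>m n. m \<noteq> n \<Longrightarrow> inf (u m) (u n) = 0" and bdd: "bounded (range u)"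
  shows "(\<lambda>n. h (u n)) \<longlonglongrightarrow> 0"
proof -
  define c where "c = (\<lambda>i. band_part h (u i))"
  have c_nonneg: "0 \<le> c i x" if "0 \<le> x" for i x
    using that by (simp add: c_def band_part_nonneg)
  \<comment> \<open>The bound is stated for the shifted sequence, so that one estimate serves all
    tails.\<close>
  have c_sum: "(\<Sum>i<k. c (i + n) x) \<le> h x" if "0 \<le> x" for k n x
    unfolding c_def using that u by (intro sum_band_part_le[of "\<lambda>i. u (i + n)"]) auto
  have summable: "summable (\<lambda>i. c (i + n) x)" if "0 \<le> x" for n x
    using that by (intro summableI_nonneg_bounded[where x = "h x"] c_nonneg c_sum)
  have tail_nonneg: "0 \<le> (\<Sum>i. c (i + n) x)" if "0 \<le> x" for n x
    using that by (intro suminf_nonneg summable c_nonneg)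
  have "\<exists>g :: 'a \<Rightarrow>\<^sub>L real. \<forall>x\<ge>0. g x = (\<Sum>i. c (i + n) x)" for n
  proof (rule cone_extension)
    fix x y :: 'a assume xy: "0 \<le> x" "0 \<le> y"
    then have "c i (x + y) = c i x + c i y" for i
      using u(1) by (simp add: c_def band_part_add)
    then show "(\<Sum>i. c (i + n) (x + y)) = (\<Sum>i. c (i + n) x) + (\<Sum>i. c (i + n) y)"
      using xy by (simp add: suminf_add summable)
  next
    fix x :: 'a assume x: "0 \<le> x"
    have "(\<Sum>i. c (i + n) x) \<le> h x"
      using x by (intro suminf_le_const summable c_sum)
    then show "\<bar>\<Sum>i. c (i + n) x\<bar> \<le> norm h * norm x"
      using tail_nonneg[OF x, of n] norm_blinfun[of h x] by simp
  qed blast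
  then obtain t :: "nat \<Rightarrow> 'a \<Rightarrow>\<^sub>L real" where t: "\<And>n x. 0 \<le> x \<Longrightarrow> t n x = (\<Sum>i. c (i + n) x)"
    by metis
  have t_nonneg: "0 \<le> t n" for n
    by (simp add: blinfun_nonneg_iff t tail_nonneg)
  have t_decr: "t n \<le> t m" if "m \<le> n" for m n
    unfolding less_eq_blinfun_def
  proof safe
    fix x :: 'a assume x: "0 \<le> x"
    have "(\<Sum>i. c (i + m) x) = (\<Sum>i. c (i + (n - m) + m) x) + (\<Sum>i<n - m. c (i + m) x)"
      by (rule suminf_split_initial_segment[OF summable[OF x]])
    moreover have "0 \<le> (\<Sum>i<n - m. c (i + m) x)" by (intro sum_nonneg c_nonneg x)
    ultimately show "t n x \<le> t m x" using that by (simp add: t x)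
  qed
  \<comment> \<open>At a positive \<open>x\<close> the tails of the convergent series fall below
    every \<open>e > 0\<close>, and \<open>b x\<close> lies below all of them.\<close>
  have t_inf: "b \<le> 0" if b: "\<And>n. b \<le> t n" for b
    unfolding less_eq_blinfun_def
  proof safe
    fix x :: 'a assume x: "0 \<le> x"
    have "b x \<le> 0 + e" if e: "0 < e" for e
    proof -
      obtain N where "norm (\<Sum>i. c (i + N) x) < e"
        using suminf_exist_split[OF e, of "\<lambda>i. c i x"] summable[OF x, of 0] by auto
      then show ?thesis using b[of N] x by (auto simp: less_eq_blinfun_def t)
    qed
    then have "b x \<le> 0" by (rule field_le_epsilon)
    then show "b x \<le> blinfun_apply 0 x" by simp
  qed
  obtain M where M: "0 < M" "\<And>n. norm (u n) \<le> M"
    using bdd by (auto simp: bounded_pos)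
  show ?thesis
  proof (rule LIMSEQ_I)
    fix e :: real assume e: "0 < e"
    \<comment> \<open>The factor \<open>1 / M\<close> compensates for the norm bound
      \<open>M\<close> of the \<open>u n\<close>.\<close>
    have "\<exists>x0\<in>range t. \<forall>x\<in>range t. x \<le> x0 \<longrightarrow> norm x < e / M"
    proof (rule oc[unfolded order_continuous_norm_def, rule_format])
      have "\<exists>k. t k \<le> t m \<and> t k \<le> t n" for m n
        by (rule exI[of _ "max m n"]) (simp add: t_decr)
      then show "range t \<noteq> {} \<and> (\<forall>x\<in>range t. \<forall>y\<in>range t. \<exists>z\<in>range t. z \<le> x \<and> z \<le> y) \<and>
          (\<forall>x\<in>range t. 0 \<le> x) \<and> (\<forall>b. (\<forall>x\<in>range t. b \<le> x) \<longrightarrow> b \<le> 0)"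
        using t_nonneg t_inf by simp
    qed (use e M in simp)
    then obtain N where N: "\<And>n. t n \<le> t N \<Longrightarrow> norm (t n) < e / M" by auto
    have "norm (h (u n) - 0) < e" if "N \<le> n" for n
    proof -
      \<comment> \<open>The component carried by \<open>u n\<close> is the summand with index 0 of
        the tail \<open>t n\<close>.\<close>
      have "h (u n) \<le> c (0 + n) (u n)" by (simp add: c_def band_part_self)
      also have "\<dots> \<le> (\<Sum>i. c (i + n) (u n))"
        using sum_le_suminf[OF summable[OF u(1), of n n], of "{0}"] by (simp add: c_nonneg u(1))
      also have "\<dots> = t n (u n)" by (simp add: t u(1))
      also have "\<dots> \<le> norm (t n) * norm (u n)" using norm_blinfun[of "t n" "u n"] by simp
      also have "\<dots> \<le> norm (t n) * M" by (intro mult_left_mono M) simp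
      also have "\<dots> < e" using N[OF t_decr[OF that]] M by (simp add: pos_less_divide_eq)
      finally show ?thesis using h u(1) by (simp add: blinfun_nonneg_iff)
    qed
    then show "\<exists>N. \<forall>n\<ge>N. norm (h (u n) - 0) < e" by blast
  qed
qed

end

section \<open>Order continuity from null values on disjoint sequences\<close>

text \<open>Directedness makes the pointwise infimum additive on the cone, so it extends to a
  functional \<open>g\<close>. This \<open>g\<close> is a lower bound of \<open>D\<close>, hence
  \<open>g \<le> 0\<close>: an infimum in the order of the dual thus becomes numerical smallness at
  the point \<open>x\<close>.\<close>

lemma directed_dual_INF:
  fixes D :: "('a::banach_lattice \<Rightarrow>\<^sub>L real) set"
  assumes D: "D \<noteq> {}" "\<And>d. d \<in> D \<Longrightarrow> 0 \<le> d"
    and directed: "\<And>d e. d \<in> D \<Longrightarrow> e \<in> D \<Longrightarrow> \<exists>r\<in>D. r \<le> d \<and> r \<le> e"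
    and inf0: "\<And>b. (\<And>d. d \<in> D \<Longrightarrow> b \<le> d) \<Longrightarrow> b \<le> 0"
    and x: "0 \<le> x" and e: "0 < e"
  shows "\<exists>d\<in>D. d x < e"
proof -
  let ?L = "\<lambda>x. INF d\<in>D. blinfun_apply d x"
  have pos: "0 \<le> d x" if "d \<in> D" "0 \<le> x" for d x
    using D(2)[OF that(1)] that(2) by (simp add: blinfun_nonneg_iff)
  have lower: "?L x \<le> d x" if "d \<in> D" "0 \<le> x" for d x
    using that pos by (intro cINF_lower bdd_belowI2[where m = 0])
  obtain d0 where d0: "d0 \<in> D" using D(1) by blast
  obtain g :: "'a \<Rightarrow>\<^sub>L real" where g: "\<And>x. 0 \<le> x \<Longrightarrow> g x = ?L x"
  proof (rule cone_extension)
    fix x y :: 'a assume xy: "0 \<le> x" "0 \<le> y"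
    have "?L x + ?L y \<le> ?L (x + y)"
      by (rule cINF_greatest[OF D(1)]) (simp add: blinfun.add_right add_mono lower xy)
    moreover have "?L (x + y) \<le> ?L x + ?L y"
    proof -
      have *: "?L (x + y) \<le> d x + e y" if de: "d \<in> D" "e \<in> D" for d e
      proof -
        obtain r where r: "r \<in> D" "r \<le> d" "r \<le> e" using directed[OF de] by blast
        then have "r x \<le> d x" "r y \<le> e y" using xy by (simp_all add: less_eq_blinfun_def)
        then show ?thesis using lower[OF r(1), of "x + y"] xy by (simp add: blinfun.add_right)
      qed
      have "?L (x + y) - d x \<le> ?L y" if "d \<in> D" for d
        by (rule cINF_greatest[OF D(1)]) (use *[OF that] in \<open>simp add: algebra_simps\<close>)
      then have "?L (x + y) - ?L y \<le> ?L x"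
        by (intro cINF_greatest[OF D(1)]) (simp add: algebra_simps)
      then show ?thesis by simp
    qed
    ultimately show "?L (x + y) = ?L x + ?L y" by simp
  next
    fix x :: 'a assume x: "0 \<le> x"
    then have "?L x \<le> norm d0 * norm x"
      using lower[OF d0 x] norm_blinfun[of d0 x] by simp
    moreover have "0 \<le> ?L x" by (rule cINF_greatest[OF D(1)]) (simp add: pos x)
    ultimately show "\<bar>?L x\<bar> \<le> norm d0 * norm x" by simp
  qed blast
  have "g \<le> 0"
    by (rule inf0) (simp add: less_eq_blinfun_def g lower)
  then have "g x \<le> 0" using x by (simp add: less_eq_blinfun_def)
  then have "?L x < e" using e g[OF x] by simp
  moreover have "bdd_below ((\<lambda>d. blinfun_apply d x) ` D)"
    by (rule bdd_belowI2[where m = 0]) (simp add: pos x)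
  ultimately show ?thesis using D(1) by (simp add: cINF_less_iff)
qed

text \<open>If no \<open>u\<close> works, choose \<open>x n\<close> in the unit ball recursively with
  \<open>h (pprt (x n - 4 ^ n *\<^sub>R (\<Sum>i<n. x i))) \<ge> e\<close>. Subtracting moreover \<open>2\<^sup>-\<^sup>n y\<close>, where
  \<open>y = (\<Sum>n. 2\<^sup>-\<^sup>n x n)\<close>, makes these elements disjoint and changes the values of \<open>h\<close> by a null
  sequence.\<close>

lemma almost_order_bounded_unit_ball:
  fixes h :: "'a::banach_lattice \<Rightarrow>\<^sub>L real"
  assumes h: "0 \<le> h" and e: "0 < e"
    and null: "\<And>x. bounded (range x) \<Longrightarrow> disjoint_sequence x \<Longrightarrow> (\<lambda>n. h (x n)) \<longlonglongrightarrow> 0"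
  shows "\<exists>u\<ge>0. \<forall>x. 0 \<le> x \<longrightarrow> norm x \<le> 1 \<longrightarrow> h (pprt (x - u)) < e"
proof (rule ccontr)
  assume "\<not> ?thesis"
  then have "\<exists>x. 0 \<le> x \<and> norm x \<le> 1 \<and> e \<le> h (pprt (x - u))" if "0 \<le> u" for u
    using that by (meson not_less)
  then obtain F where F: "\<And>u. 0 \<le> u \<Longrightarrow> 0 \<le> F u \<and> norm (F u) \<le> 1 \<and> e \<le> h (pprt (F u - u))"
    by metis
  \<comment> \<open>The state of the recursion is the sum of the elements chosen so far, since the
    next choice depends on this sum alone and on \<open>n\<close>.\<close>
  define s where "s = rec_nat (0 :: 'a) (\<lambda>n s. s + F (4 ^ n *\<^sub>R s))"
  define x where "x = (\<lambda>n. F (4 ^ n *\<^sub>R s n))"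
  have s_0: "s 0 = 0" and s_Suc: "s (Suc n) = s n + x n" for n
    by (simp_all add: s_def x_def)
  have s_nonneg: "0 \<le> s n" for n
    by (induction n) (simp_all add: s_0 s_Suc x_def F scaleR_nonneg_nonneg)
  then have x: "0 \<le> x n" "norm (x n) \<le> 1" "e \<le> h (pprt (x n - 4 ^ n *\<^sub>R s n))" for n
    using F[of "4 ^ n *\<^sub>R s n"] by (simp_all add: x_def scaleR_nonneg_nonneg)
  have s_eq: "s n = (\<Sum>i<n. x i)" for n
    by (induction n) (simp_all add: s_0 s_Suc)
  have x_le_s: "x m \<le> s n" if "m < n" for m n
  proof -
    have "sum x {m} \<le> (\<Sum>i<n. x i)" using that x(1) by (intro sum_mono2) auto
    then show ?thesis by (simp add: s_eq)
  qed
  define y where "y = (\<Sum>n. (1 / 2) ^ n *\<^sub>R x n)"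
  have "summable (\<lambda>n. (1 / 2) ^ n *\<^sub>R x n)"
    by (rule summable_comparison_test'[of "\<lambda>n. (1 / 2) ^ n" 0])
      (use x(2) in \<open>auto simp: mult_left_le\<close>)
  then have "(\<lambda>n. (1 / 2) ^ n *\<^sub>R x n) sums y" by (simp add: y_def summable_sums)
  then have x_le_y: "(1 / 2) ^ n *\<^sub>R x n \<le> y" for n
    using x(1) by (intro term_le_sums_cone[of "\<lambda>n. (1 / 2) ^ n *\<^sub>R x n"]) (auto simp: scaleR_nonneg_nonneg)
  have y_nonneg: "0 \<le> y" using order_trans[OF _ x_le_y[of 0], of 0] x(1)[of 0] by simp
  define v where "v = (\<lambda>n. pprt (x n - 4 ^ n *\<^sub>R s n - (1 / 2) ^ n *\<^sub>R y))"
  have v_nonneg: "0 \<le> v n" for n by (simp add: v_def)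
  have disj: "inf (v m) (v n) = 0" if "m < n" for m n
  proof -
    \<comment> \<open>The factor satisfies two demands. Since \<open>y\<close> dominates
      \<open>x n\<close> scaled by \<open>(1 / 2) ^ n\<close>, the term subtracted in
      \<open>v m\<close> dominates \<open>x n\<close> scaled by \<open>1 / K\<close>; since
      \<open>K \<le> 4 ^ n\<close>, the term subtracted in \<open>v n\<close> dominates
      \<open>x m\<close> scaled by \<open>K\<close>. So \<open>v m\<close> scaled by
      \<open>K\<close> and \<open>v n\<close> lie below the two disjoint parts of
      \<open>z\<close>.\<close>
    define K :: real where "K = 2 ^ (m + n)"
    have K: "0 < K" "K \<le> 4 ^ n"
    proof -
      have "K \<le> 2 ^ (n + n)" unfolding K_def using that by (intro power_increasing) auto
      then show "K \<le> 4 ^ n" by (simp add: power_add power_mult_distrib[symmetric])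
    qed (simp add: K_def)
    define z where "z = x n - K *\<^sub>R x m"
    have "inf (pprt (- z)) (pprt z) = 0" using pprt_disjoint[of "- z"] by simp
    moreover have "K *\<^sub>R v m \<le> pprt (- z)"
    proof -
      have "(1 / K) *\<^sub>R x n = (1 / 2) ^ m *\<^sub>R ((1 / 2) ^ n *\<^sub>R x n)"
        by (simp add: K_def power_add power_one_over)
      also have "\<dots> \<le> (1 / 2) ^ m *\<^sub>R y" by (intro scaleR_left_mono x_le_y) simp
      finally have "K *\<^sub>R ((1 / K) *\<^sub>R x n) \<le> K *\<^sub>R ((1 / 2) ^ m *\<^sub>R y)"
        using K by (intro scaleR_left_mono) auto
      then have "x n \<le> K *\<^sub>R ((1 / 2) ^ m *\<^sub>R y)" using K by simp
      moreover have "0 \<le> K *\<^sub>R (4 ^ m *\<^sub>R s m)"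
        using K s_nonneg by (intro scaleR_nonneg_nonneg) auto
      ultimately have "x n \<le> K *\<^sub>R (4 ^ m *\<^sub>R s m) + K *\<^sub>R ((1 / 2) ^ m *\<^sub>R y)"
        by (intro add_increasing)
      then have "K *\<^sub>R (x m - 4 ^ m *\<^sub>R s m - (1 / 2) ^ m *\<^sub>R y) \<le> - z"
        by (simp add: z_def algebra_simps)
      then show ?thesis using K by (simp add: v_def pprt_scaleR[symmetric])
    qed
    moreover have "v n \<le> pprt z"
    proof -
      have "K *\<^sub>R x m \<le> 4 ^ n *\<^sub>R s n" using K x_le_s[OF that] x(1) by (intro scaleR_mono) auto
      moreover have "0 \<le> (1 / 2) ^ n *\<^sub>R y" using y_nonneg by (intro scaleR_nonneg_nonneg) auto
      ultimately have "x n - 4 ^ n *\<^sub>R s n - (1 / 2) ^ n *\<^sub>R y \<le> z"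
        using add_mono[of "K *\<^sub>R x m" _ 0] by (simp add: z_def algebra_simps)
      then show ?thesis unfolding v_def by simp
    qed
    moreover have "0 \<le> K *\<^sub>R v m" using K v_nonneg by (intro scaleR_nonneg_nonneg) auto
    ultimately have "inf (K *\<^sub>R v m) (v n) = 0"
      using v_nonneg by (metis disjoint_mono)
    moreover have "v m \<le> K *\<^sub>R v m"
      using scaleR_right_mono[of 1 K "v m"] v_nonneg[of m] by (simp add: K_def)
    ultimately show ?thesis
      using v_nonneg by (metis disjoint_mono order_refl)
  qed
  have "disjoint_sequence v"
    unfolding disjoint_sequence_def using disj v_nonneg
    by (metis abs_of_nonneg inf_commute linorder_neqE_nat)
  moreover have "bounded (range v)"
  proof (rule boundedI[of _ 1])
    fix w assume "w \<in> range v"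
    then obtain n where w: "w = v n" by blast
    have "0 \<le> 4 ^ n *\<^sub>R s n" "0 \<le> (1 / 2) ^ n *\<^sub>R y"
      using s_nonneg y_nonneg by (auto intro!: scaleR_nonneg_nonneg)
    then have "x n - 4 ^ n *\<^sub>R s n - (1 / 2) ^ n *\<^sub>R y \<le> x n - 0 - 0"
      by (intro diff_mono order_refl)
    then have "v n \<le> x n" using x(1) by (simp add: v_def pprt_def)
    then show "norm w \<le> 1" using norm_mono[OF v_nonneg, of n "x n"] x(2)[of n] w by simp
  qed
  ultimately have "(\<lambda>n. h (v n)) \<longlonglongrightarrow> 0" by (intro null)
  moreover have "(\<lambda>n. (1 / 2) ^ n * h y) \<longlonglongrightarrow> 0"
    by (intro tendsto_mult_left_zero LIMSEQ_power_zero) simp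
  ultimately have "(\<lambda>n. h (v n) + (1 / 2) ^ n * h y) \<longlonglongrightarrow> 0 + 0"
    by (rule tendsto_add)
  moreover have "e \<le> h (v n) + (1 / 2) ^ n * h y" for n
  proof -
    have "0 \<le> (1 / 2) ^ n *\<^sub>R y" using y_nonneg by (intro scaleR_nonneg_nonneg) auto
    then have "pprt (x n - 4 ^ n *\<^sub>R s n) \<le> v n + (1 / 2) ^ n *\<^sub>R y"
      unfolding pprt_def[of "x n - _"]
      by (intro sup_least add_nonneg_nonneg v_nonneg) (simp_all add: v_def pprt_def diff_le_eq[symmetric])
    from blinfun_mono[OF h this] show ?thesis
      using x(3)[of n] by (simp add: blinfun.add_right blinfun.scaleR_right)
  qed
  ultimately have "e \<le> 0 + 0" by (intro LIMSEQ_le_const) auto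
  then show False using e by simp
qed

text \<open>A positive \<open>x\<close> in the unit ball lies below \<open>u + pprt (x - u)\<close>.
  For \<open>d\<close> below both \<open>d0\<close> and \<open>d1\<close>, the first summand is
  controlled by \<open>d1 u\<close> and the second by \<open>d0\<close>, each with share
  \<open>e / 4\<close>.\<close>

lemma order_continuous_dualI:
  assumes null: "\<And>(h :: 'a::banach_lattice \<Rightarrow>\<^sub>L real) x.
      0 \<le> h \<Longrightarrow> bounded (range x) \<Longrightarrow> disjoint_sequence x \<Longrightarrow> (\<lambda>n. blinfun_apply h (x n)) \<longlonglongrightarrow> 0"
  shows "order_continuous_norm TYPE('a \<Rightarrow>\<^sub>L real)"
  unfolding order_continuous_norm_def
proof (intro allI impI, elim conjE)
  fix D :: "('a \<Rightarrow>\<^sub>L real) set" and e :: real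
  assume "D \<noteq> {}" and directed: "\<forall>x\<in>D. \<forall>y\<in>D. \<exists>z\<in>D. z \<le> x \<and> z \<le> y" and pos: "\<forall>x\<in>D. 0 \<le> x"
    and inf0: "\<forall>b. (\<forall>x\<in>D. b \<le> x) \<longrightarrow> b \<le> 0" and e: "0 < e"
  obtain d0 where d0: "d0 \<in> D" using \<open>D \<noteq> {}\<close> by blast
  have h0: "0 \<le> d0" using pos d0 by blast
  obtain u where u: "0 \<le> u" "\<And>x. 0 \<le> x \<Longrightarrow> norm x \<le> 1 \<Longrightarrow> d0 (pprt (x - u)) < e / 4"
    using almost_order_bounded_unit_ball[OF h0, of "e / 4"] null[OF h0] e by auto
  obtain d1 where d1: "d1 \<in> D" "d1 u < e / 4"
    using directed_dual_INF[of D u "e / 4"] d0 pos directed inf0 u(1) e by auto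
  obtain d where d: "d \<in> D" "d \<le> d0" "d \<le> d1" using directed d0 d1(1) by blast
  have d_pos: "0 \<le> d" using pos d(1) by blast
  have "norm d \<le> e / 2"
  proof (rule blinfun_norm_le_cone[OF d_pos])
    fix x :: 'a assume x: "0 \<le> x" "norm x \<le> 1"
    have "x \<le> u + pprt (x - u)" by (simp add: pprt_def add_sup_distrib_left)
    then have "d x \<le> d u + d (pprt (x - u))"
      using blinfun_mono[OF d_pos] by (metis blinfun.add_right)
    also have "d u \<le> d1 u" using d(3) u(1) by (simp add: less_eq_blinfun_def)
    also have "d (pprt (x - u)) \<le> d0 (pprt (x - u))" using d(2) by (simp add: less_eq_blinfun_def)
    finally show "d x \<le> e / 2" using d1(2) u(2)[OF x] by simp
  qed (use e in simp)
  then have "norm d < e" using e by simp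
  then have "norm r < e" if "r \<in> D" "r \<le> d" for r
    using blinfun_norm_mono[of r d] that pos by force
  then show "\<exists>x0\<in>D. \<forall>x\<in>D. x \<le> x0 \<longrightarrow> norm x < e" using d(1) by blast
qed

subsection \<open>Operators with strong order bounded adjoint\<close>

lemma strong_order_bounded_iff:
  "strong_order_bounded X N S \<longleftrightarrow> (\<exists>l h. \<forall>x\<in>X. N x \<le> 1 \<longrightarrow> l \<le> S x \<and> S x \<le> h)"
proof
  assume "strong_order_bounded X N S"
  then obtain l h where "\<And>z. z \<in> S ` {x \<in> X. N x \<le> 1} \<Longrightarrow> z \<le> h" "\<And>z. z \<in> S ` {x \<in> X. N x \<le> 1} \<Longrightarrow> l \<le> z"
    by (auto simp: strong_order_bounded_def bdd_above_def bdd_below_def)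
  then show "\<exists>l h. \<forall>x\<in>X. N x \<le> 1 \<longrightarrow> l \<le> S x \<and> S x \<le> h" by blast
next
  assume "\<exists>l h. \<forall>x\<in>X. N x \<le> 1 \<longrightarrow> l \<le> S x \<and> S x \<le> h"
  then show "strong_order_bounded X N S"
    unfolding strong_order_bounded_def bdd_above_def bdd_below_def by blast
qed

text \<open>On the positive part of \<open>z\<close> the functional \<open>g\<close> is at most
  \<open>h\<close>, on the negative part at least \<open>l\<close>. Adding the two missing terms,
  which are nonnegative by \<open>l \<le> 0 \<le> h\<close>, completes the bound to
  \<open>h - l\<close> at \<open>\<bar>z\<bar>\<close>.\<close>

lemma abs_le_of_order_interval:
  fixes g :: "'a::banach_lattice \<Rightarrow>\<^sub>L real"
  assumes "l \<le> g" "g \<le> h" "l \<le> 0" "0 \<le> h"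
  shows "\<bar>g x\<bar> \<le> (h - l) \<bar>x\<bar>"
proof -
  have *: "g z \<le> (h - l) \<bar>z\<bar>" for z
  proof -
    have "g z = g (pprt z) - g (pprt (- z))" by (simp only: blinfun.diff_right[symmetric] pprt_diff)
    also have "\<dots> \<le> h (pprt z) - l (pprt (- z))"
      using assms(1,2) by (intro diff_mono) (simp_all add: less_eq_blinfun_def)
    also have "\<dots> \<le> h (pprt z) - l (pprt (- z)) + (h (pprt (- z)) - l (pprt z))"
      using assms(3,4) by (simp add: less_eq_blinfun_def order_trans[of _ 0])
    also have "\<dots> = (h - l) \<bar>z\<bar>"
      by (simp add: abs_eq_pprt blinfun.diff_left blinfun.add_right)
    finally show ?thesis .
  qed
  show ?thesis using *[of x] *[of "- x"] by (simp add: blinfun.minus_right abs_le_iff)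
qed

section \<open>Operators dominated by a positive functional\<close>

lemma M_weakly_compact_if_dominated:
  fixes H :: "'a::banach_lattice \<Rightarrow>\<^sub>L real"
  assumes oc: "order_continuous_norm TYPE('a \<Rightarrow>\<^sub>L real)" and H: "0 \<le> H"
    and dom: "\<And>x. 0 \<le> N (T x)" "\<And>x. N (T x) \<le> H \<bar>x\<bar>"
  shows "M_weakly_compact N T"
  unfolding M_weakly_compact_def
proof safe
  fix x :: "nat \<Rightarrow> 'a" assume x: "bounded (range x)" "disjoint_sequence x"
  have "(\<lambda>n. H \<bar>x n\<bar>) \<longlonglongrightarrow> 0"
  proof (rule order_continuous_dual_imp_tendsto_0[OF H oc])
    show "bounded (range (\<lambda>n. \<bar>x n\<bar>))"
      using x(1) by (simp add: bounded_iff norm_abs_eq)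
  qed (use x(2) in \<open>auto simp: disjoint_sequence_def\<close>)
  then show "(\<lambda>n. N (T (x n))) \<longlonglongrightarrow> 0"
    by (rule tendsto_sandwich[OF _ _ tendsto_const, rotated 2]) (simp_all add: dom)
qed

text \<open>A norming functional \<open>f\<close> of \<open>T x\<close> lies in the dual unit ball,
  so \<open>N (T x)\<close> is the value at \<open>x\<close> of an element of the order interval
  from \<open>l\<close> to \<open>h\<close>.\<close>

lemma M_weakly_compact_on:
  fixes T :: "'a::banach_lattice \<Rightarrow> 'v::real_vector"
  assumes oc: "order_continuous_norm TYPE('a \<Rightarrow>\<^sub>L real)"
    and VN: "banach_space_on V N" and T: "operator_into V N T"
    and sob: "strong_order_bounded (dual_on V N) (dual_norm_on V N) (adjoint_on T)"
  shows "M_weakly_compact N T"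
proof -
  have TV: "T x \<in> V" for x using T by (auto simp: operator_into_def)
  obtain K where K: "\<And>x. N (T x) \<le> K * norm x" using T by (auto simp: operator_into_def)
  have N_nonneg: "0 \<le> N x" if "x \<in> V" for x using VN that by (simp add: banach_space_on_def)
  \<comment> \<open>\<open>Blinfun\<close> returns the given function only if that function is
    bounded and linear.\<close>
  have adj: "adjoint_on T f x = f (T x)" if f: "f \<in> dual_on V N" for f x
  proof -
    obtain L where L: "\<And>x. x \<in> V \<Longrightarrow> \<bar>f x\<bar> \<le> L * N x" using f unfolding dual_on_def by blast
    have "bounded_linear (\<lambda>x. f (T x))"
    proof (rule bounded_linear_intro[where K = "\<bar>L\<bar> * K"])
      have lin: "linear T" using T by (simp add: operator_into_def)
      show "f (T (x + y)) = f (T x) + f (T y)" "f (T (c *\<^sub>R x)) = c *\<^sub>R f (T x)" for x y c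
        using f TV by (auto simp: dual_on_def linear_add[OF lin] linear_scale[OF lin])
      fix x
      have "\<bar>f (T x)\<bar> \<le> L * N (T x)" by (rule L[OF TV])
      also have "\<dots> \<le> \<bar>L\<bar> * N (T x)" by (intro mult_right_mono N_nonneg TV) simp
      also have "\<dots> \<le> \<bar>L\<bar> * (K * norm x)" by (intro mult_left_mono K) simp
      finally show "norm (f (T x)) \<le> norm x * (\<bar>L\<bar> * K)" by (simp add: algebra_simps)
    qed
    then show ?thesis by (simp add: adjoint_on_def bounded_linear_Blinfun_apply)
  qed
  let ?B = "{f \<in> dual_on V N. dual_norm_on V N f \<le> 1}"
  obtain h l where hl: "\<And>f. f \<in> ?B \<Longrightarrow> l \<le> adjoint_on T f \<and> adjoint_on T f \<le> h"
    using sob unfolding strong_order_bounded_iff by blast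
  have "subspace V" "\<forall>x\<in>V. N x = 0 \<longleftrightarrow> x = 0" using VN unfolding banach_space_on_def by fast+
  then have "0 \<in> {x \<in> V. N x \<le> 1}" using subspace_0[of V] by force
  then have ne: "{x \<in> V. N x \<le> 1} \<noteq> {}" by blast
  \<comment> \<open>The zero functional in the dual ball forces
    \<open>l \<le> 0 \<le> h\<close>.\<close>
  have "(\<lambda>_. 0) \<in> ?B"
  proof
    have "dual_norm_on V N (\<lambda>_. 0) \<le> 1"
      unfolding dual_norm_on_def by (rule cSUP_least[OF ne]) simp
    moreover have "(\<lambda>_. 0) \<in> dual_on V N" by (auto simp: dual_on_def intro: exI[of _ 0])
    ultimately show "(\<lambda>_. 0) \<in> dual_on V N \<and> dual_norm_on V N (\<lambda>_. 0) \<le> 1" by blast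
  qed
  moreover from this have "adjoint_on T (\<lambda>_. 0) = 0" by (intro blinfun_eqI) (simp add: adj)
  ultimately have hl0: "l \<le> 0" "0 \<le> h" using hl by force+
  show ?thesis
  proof (rule M_weakly_compact_if_dominated[OF oc])
    show "0 \<le> h - l" using hl0 by (simp add: less_eq_blinfun_def blinfun.diff_left order_trans[of _ 0])
    show "0 \<le> N (T x)" for x by (rule N_nonneg[OF TV])
    show "N (T x) \<le> (h - l) \<bar>x\<bar>" for x
    proof -
      obtain f where f: "f \<in> ?B" "f (T x) = N (T x)" using norming_functional_on[OF VN TV] by blast
      then show ?thesis
        using abs_le_of_order_interval[of l "adjoint_on T f" h x] hl[OF f(1)] hl0 adj[of f x] by simp
    qed
  qed
qed

text \<open>The coordinate evaluations have norm at most 1 and determine the supremum norm; they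
  take the place of a norming functional.\<close>

lemma M_weakly_compact_l_infty:
  fixes T :: "'a::banach_lattice \<Rightarrow>\<^sub>L l_infty"
  assumes oc: "order_continuous_norm TYPE('a \<Rightarrow>\<^sub>L real)"
    and sob: "strong_order_bounded UNIV norm (dual_adjoint T)"
  shows "M_weakly_compact norm (blinfun_apply T)"
proof -
  obtain h l where hl: "\<And>f :: l_infty \<Rightarrow>\<^sub>L real. norm f \<le> 1 \<Longrightarrow> l \<le> f o\<^sub>L T \<and> f o\<^sub>L T \<le> h"
    using sob unfolding strong_order_bounded_iff dual_adjoint_def by blast
  have hl0: "l \<le> 0" "0 \<le> h" using hl[of 0] by simp_all
  show ?thesis
  proof (rule M_weakly_compact_if_dominated[OF oc])
    show "0 \<le> h - l" using hl0 by (simp add: less_eq_blinfun_def blinfun.diff_left order_trans[of _ 0])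
    show "norm (T x) \<le> (h - l) \<bar>x\<bar>" for x
    proof (rule norm_bound)
      fix n
      let ?ev = "\<lambda>f :: l_infty. apply_bcontfun f n"
      have le: "\<bar>?ev f\<bar> \<le> norm f" for f using norm_bounded[of f n] by simp
      have ev: "bounded_linear ?ev"
        by (rule bounded_linear_intro[where K = 1]) (use le in \<open>auto simp: plus_bcontfun.rep_eq scaleR_bcontfun.rep_eq\<close>)
      then have "norm (Blinfun ?ev) \<le> 1"
        by (intro norm_blinfun_bound) (use le in \<open>auto simp: bounded_linear_Blinfun_apply\<close>)
      from hl[OF this] show "norm (apply_bcontfun (T x) n) \<le> (h - l) \<bar>x\<bar>"
        using abs_le_of_order_interval[of l "Blinfun ?ev o\<^sub>L T" h x] hl0 ev
        by (simp add: bounded_linear_Blinfun_apply)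
    qed
  qed simp
qed

section \<open>Operators of rank one\<close>

lemma scaleR_blinfun_in_interval:
  fixes h :: "'a::banach_lattice \<Rightarrow>\<^sub>L real"
  assumes "0 \<le> h" "\<bar>c\<bar> \<le> 1"
  shows "c *\<^sub>R h \<le> h" "- h \<le> c *\<^sub>R h"
  unfolding less_eq_blinfun_def
proof safe
  fix x :: 'a assume "0 \<le> x"
  then have hx: "0 \<le> h x" using assms(1) by (simp add: blinfun_nonneg_iff)
  show "(c *\<^sub>R h) x \<le> h x"
    using mult_right_mono[of c 1 "h x"] assms(2) hx by (simp add: blinfun.scaleR_left)
  show "(- h) x \<le> (c *\<^sub>R h) x"
    using mult_right_mono[of "- 1" c "h x"] assms(2) hx
    by (simp add: blinfun.scaleR_left blinfun.minus_left)
qed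

text \<open>The codomain is the line through \<open>v\<close>, normed by the absolute value of the
  coordinate. The adjoint maps \<open>f\<close> to \<open>h\<close> scaled by \<open>f v\<close>,
  where \<open>\<bar>f v\<bar> \<le> 1\<close> on the dual ball, so its values lie between
  \<open>- h\<close> and \<open>h\<close>.\<close>

lemma rank_one_on:
  fixes h :: "'a::banach_lattice \<Rightarrow>\<^sub>L real" and v :: "'v::real_vector"
  assumes h: "0 \<le> h" and v: "v \<noteq> 0"
  obtains V N where "banach_space_on V N" "operator_into V N (\<lambda>x. h x *\<^sub>R v)"
    "strong_order_bounded (dual_on V N) (dual_norm_on V N) (adjoint_on (\<lambda>x. h x *\<^sub>R v))"
    "\<And>c. N (c *\<^sub>R v) = \<bar>c\<bar>"
proof -
  have "linear (\<lambda>c. c *\<^sub>R v)" by (simp add: linear_iff scaleR_left_distrib)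
  moreover have "inj (\<lambda>c. c *\<^sub>R v)" using v by (simp add: inj_def)
  \<comment> \<open>A linear left inverse is the coordinate functional extended to the whole type;
    it makes \<open>N\<close> a seminorm everywhere and a norm on \<open>V\<close>.\<close>
  ultimately obtain g :: "'v \<Rightarrow> real" where g: "linear g" "\<And>c. g (c *\<^sub>R v) = c"
    using linear_exists_left_inverse_on[of "\<lambda>c. c *\<^sub>R v" UNIV] by auto
  define V where "V = range (\<lambda>c. c *\<^sub>R v)"
  define N where "N = (\<lambda>w. \<bar>g w\<bar>)"
  have N: "N (c *\<^sub>R v) = \<bar>c\<bar>" for c by (simp add: N_def g(2))
  have V_eq: "w = g w *\<^sub>R v" if "w \<in> V" for w using that by (auto simp: V_def g(2))
  have VI: "c *\<^sub>R v \<in> V" for c unfolding V_def by (rule rangeI)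
  have "v \<in> V" using VI[of 1] by simp
  have subspace: "subspace V"
    unfolding V_def using linear_subspace_image[OF \<open>linear (\<lambda>c. c *\<^sub>R v)\<close> subspace_UNIV] by simp
  have banach: "banach_space_on V N"
    unfolding banach_space_on_def
  proof (intro conjI ballI allI impI)
    show "N x = 0 \<longleftrightarrow> x = 0" if "x \<in> V" for x
      using V_eq[OF that] linear_0[OF g(1)] by (auto simp: N_def)
    show "N (c *\<^sub>R x) = \<bar>c\<bar> * N x" for c x by (simp add: N_def linear_scale[OF g(1)] abs_mult)
    show "N (x + y) \<le> N x + N y" for x y by (simp add: N_def linear_add[OF g(1)])
    fix X :: "nat \<Rightarrow> 'v"
    assume X: "(\<forall>n. X n \<in> V) \<and> (\<forall>e>0. \<exists>M. \<forall>m\<ge>M. \<forall>n\<ge>M. N (X m - X n) < e)"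
    then have "Cauchy (\<lambda>n. g (X n))"
      by (simp add: Cauchy_def dist_real_def N_def linear_diff[OF g(1)])
    then obtain c where "(\<lambda>n. g (X n)) \<longlonglongrightarrow> c"
      by (auto simp: Cauchy_convergent_iff convergent_def)
    then have "(\<lambda>n. N (X n - c *\<^sub>R v)) \<longlonglongrightarrow> 0"
      by (simp add: N_def linear_diff[OF g(1)] g(2) tendsto_rabs_zero_iff LIM_zero)
    then show "\<exists>l\<in>V. (\<lambda>n. N (X n - l)) \<longlonglongrightarrow> 0" using VI by blast
  qed (simp_all add: subspace N_def)
  have "linear (\<lambda>x. h x *\<^sub>R v)"
    by (simp add: linear_iff blinfun.add_right blinfun.scaleR_right scaleR_left_distrib)
  then have operator: "operator_into V N (\<lambda>x. h x *\<^sub>R v)"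
    unfolding operator_into_def using norm_blinfun[of h] VI by (auto simp: N)
  have "- h \<le> adjoint_on (\<lambda>x. h x *\<^sub>R v) f \<and> adjoint_on (\<lambda>x. h x *\<^sub>R v) f \<le> h"
    if f: "f \<in> dual_on V N" "dual_norm_on V N f \<le> 1" for f
  proof -
    obtain K where K: "\<And>x. x \<in> V \<Longrightarrow> \<bar>f x\<bar> \<le> K * N x" using f(1) unfolding dual_on_def by blast
    have "\<bar>f v\<bar> \<le> dual_norm_on V N f"
      unfolding dual_norm_on_def
    proof (rule cSUP_upper)
      show "v \<in> {x \<in> V. N x \<le> 1}" using \<open>v \<in> V\<close> N[of 1] by simp
      \<comment> \<open>Boundedness of \<open>f\<close> makes the supremum in
        \<open>dual_norm_on\<close> an actual upper bound.\<close>
      show "bdd_above ((\<lambda>x. \<bar>f x\<bar>) ` {x \<in> V. N x \<le> 1})"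
      proof (rule bdd_aboveI2)
        fix x assume x: "x \<in> {x \<in> V. N x \<le> 1}"
        then have "\<bar>f x\<bar> \<le> K * N x" using K by simp
        also have "\<dots> \<le> \<bar>K\<bar> * 1" using x by (intro mult_mono) (auto simp: N_def)
        finally show "\<bar>f x\<bar> \<le> \<bar>K\<bar>" by simp
      qed
    qed
    then have "\<bar>f v\<bar> \<le> 1" using f(2) by simp
    moreover have "(\<lambda>x. f (h x *\<^sub>R v)) = blinfun_apply (f v *\<^sub>R h)"
      using f(1) \<open>v \<in> V\<close> by (auto simp: dual_on_def blinfun.scaleR_left)
    then have "adjoint_on (\<lambda>x. h x *\<^sub>R v) f = f v *\<^sub>R h"
      by (simp add: adjoint_on_def blinfun_apply_inverse)
    ultimately show ?thesis using scaleR_blinfun_in_interval[OF h] by simp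
  qed
  then have "strong_order_bounded (dual_on V N) (dual_norm_on V N) (adjoint_on (\<lambda>x. h x *\<^sub>R v))"
    unfolding strong_order_bounded_iff by blast
  with banach operator show ?thesis using N by (rule that)
qed

text \<open>The constant sequence 1, a unit vector, plays the role of \<open>v\<close>.\<close>

lemma rank_one_l_infty:
  fixes h :: "'a::banach_lattice \<Rightarrow>\<^sub>L real"
  assumes h: "0 \<le> h"
  obtains T :: "'a \<Rightarrow>\<^sub>L l_infty"
  where "strong_order_bounded UNIV norm (dual_adjoint T)" "\<And>x. norm (T x) = \<bar>h x\<bar>"
proof -
  let ?one = "const_bcontfun 1 :: l_infty"
  have "norm ?one = 1"
  proof (rule antisym)
    show "norm ?one \<le> 1" by (rule norm_bound) (simp add: const_bcontfun.rep_eq)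
    show "1 \<le> norm ?one" using norm_bounded[of ?one 0] by (simp add: const_bcontfun.rep_eq)
  qed
  define T where "T = blinfun_scaleR_left ?one o\<^sub>L h"
  have T: "T x = h x *\<^sub>R ?one" for x by (simp add: T_def)
  have "- h \<le> dual_adjoint T f \<and> dual_adjoint T f \<le> h" if "norm f \<le> 1" for f
  proof -
    have "dual_adjoint T f = f ?one *\<^sub>R h"
      by (rule blinfun_eqI) (simp add: dual_adjoint_def T blinfun.scaleR_left blinfun.scaleR_right)
    moreover have "\<bar>f ?one\<bar> \<le> 1"
      using norm_blinfun[of f ?one] that \<open>norm ?one = 1\<close> by simp
    ultimately show ?thesis using scaleR_blinfun_in_interval[OF h] by simp
  qed
  then have "strong_order_bounded UNIV norm (dual_adjoint T)"
    unfolding strong_order_bounded_iff by blast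
  moreover have "norm (T x) = \<bar>h x\<bar>" for x using \<open>norm ?one = 1\<close> by (simp add: T)
  ultimately show ?thesis by (rule that)
qed

text \<open>In a type \<open>'v\<close> consisting of 0 alone every operator is zero, and the
  condition on operators would hold for every \<open>'a\<close>. One nonzero vector suffices for the
  converse, which tests the condition on operators of rank one.\<close>

theorem corollary2p5:
  assumes nontrivial_universe: "\<exists>v :: 'v::real_vector. v \<noteq> 0"
  shows
    "(order_continuous_norm TYPE('a::banach_lattice \<Rightarrow>\<^sub>L real)
      \<longleftrightarrow>
      (\<forall>(V :: 'v set) N (T :: 'a \<Rightarrow> 'v).
         banach_space_on V N \<and> operator_into V N T \<and>
         strong_order_bounded (dual_on V N) (dual_norm_on V N) (adjoint_on T) \<longrightarrow>
         M_weakly_compact N T))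
     \<and>
     (order_continuous_norm TYPE('a \<Rightarrow>\<^sub>L real)
      \<longleftrightarrow>
      (\<forall>T :: 'a \<Rightarrow>\<^sub>L l_infty.
         strong_order_bounded UNIV norm (dual_adjoint T) \<longrightarrow>
         M_weakly_compact norm (blinfun_apply T)))"
    (is "(?oc \<longleftrightarrow> ?all) \<and> (_ \<longleftrightarrow> ?l_infty)")
proof (intro conjI iffI)
  assume ?oc
  then show ?all using M_weakly_compact_on by blast
next
  assume all: ?all
  obtain v :: 'v where v: "v \<noteq> 0" using nontrivial_universe by blast
  show ?oc
  proof (rule order_continuous_dualI)
    fix h :: "'a \<Rightarrow>\<^sub>L real" and x :: "nat \<Rightarrow> 'a"
    assume h: "0 \<le> h" and x: "bounded (range x)" "disjoint_sequence x"
    obtain V N where VN: "banach_space_on V N" "operator_into V N (\<lambda>x. h x *\<^sub>R v)"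
      "strong_order_bounded (dual_on V N) (dual_norm_on V N) (adjoint_on (\<lambda>x. h x *\<^sub>R v))"
      "\<And>c. N (c *\<^sub>R v) = \<bar>c\<bar>"
      using rank_one_on[OF h v] by blast
    then have "M_weakly_compact N (\<lambda>x. h x *\<^sub>R v)" using all by blast
    then show "(\<lambda>n. h (x n)) \<longlonglongrightarrow> 0"
      using x by (auto simp: M_weakly_compact_def VN(4) tendsto_rabs_zero_iff)
  qed
next
  assume ?oc
  then show ?l_infty using M_weakly_compact_l_infty by blast
next
  assume l_infty: ?l_infty
  show ?oc
  proof (rule order_continuous_dualI)
    fix h :: "'a \<Rightarrow>\<^sub>L real" and x :: "nat \<Rightarrow> 'a"
    assume h: "0 \<le> h" and x: "bounded (range x)" "disjoint_sequence x"
    obtain T :: "'a \<Rightarrow>\<^sub>L l_infty"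
      where T: "strong_order_bounded UNIV norm (dual_adjoint T)" "\<And>x. norm (T x) = \<bar>h x\<bar>"
      using rank_one_l_infty[OF h] by blast
    then have "M_weakly_compact norm (blinfun_apply T)" using l_infty by blast
    then show "(\<lambda>n. h (x n)) \<longlonglongrightarrow> 0"
      using x by (auto simp: M_weakly_compact_def T(2) tendsto_rabs_zero_iff)
  qed
qed

end
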